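(* Let $(H^+,\oplus)$ be a gyrogroup, let $H^-$ be a set disjoint from $H^+$, let $\varphi:H^+\to H^-$ be a bijection, and let $(G,\otimes)$, $G=H^+\cup H^-$, be the gyrogroup defined in the context. A nonempty subset $B$ of $G$ is a subgyrogroup of $G$ if and only if one of the following holds: (1) $B\leq H^+$; (2) there exist $A^+\leq H^+$ and $L^-\subseteq H^-$ such that $B=A^+\cup L^-$, for all $x,y\in L^-$ we have $x\otimes y\in A^+$, and, with $L^+=\varphi^{-1}(L^-)$, $A^+\cap L^+=\emptyset$ and $A^+\cup L^+\leq H^+$; (3) $B=A^+\cup A^-$ for some $A^+\leq H^+$, where $A^-=\varphi(A^+)$.
   Context: A groupoid $(G,\oplus)$ is a gyrogroup if: (i) there is $0\in G$ with $0\oplus x=x$ for all $x\in G$; (ii) for each $a\in G$ there is $b\in G$ with $b\oplus a=0$; (iii) there is a function $\mathrm{gyr}:G\times G\to \mathrm{Aut}(G,\oplus)$, written $\mathrm{gyr}[a,b]c=\mathrm{gyr}(a,b)(c)$, such that $a\oplus(b\oplus c)=(a\oplus b)\oplus \mathrm{gyr}[a,b]c$ for all $a,b,c\in G$; (iv) $\mathrm{gyr}[a,b]=\mathrm{gyr}[a\oplus b,b]$ for all $a,b\in G$. A nonempty subset $H$ of a gyrogroup $T$ is a subgyrogroup of $T$, written $H\leq T$, if $H$ is a gyrogroup under the operation inherited from $T$ and for all $a,b\in H$ the restriction of $\mathrm{gyr}[a,b]$ to $H$ is an automorphism of $H$. Construction. An arbitrary element of $H^+$ is denoted $x^+$, and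 $x^-=\varphi(x^+)$; for $h\in H^+$, $(h)^-$ means $\varphi(h)$. Every element of $G=H^+\cup H^-$ is uniquely of the form $x^{\epsilon}$ with $x^+\in H^+$, $\epsilon\in\{+,-\}$. The operation on $G$ is $a^{\epsilon}\otimes b^{\delta}=a^+\oplus b^+$ if $\epsilon=\delta$, and $a^{\epsilon}\otimes b^{\delta}=(a^+\oplus b^+)^-$ if $\epsilon\neq\delta$. Then $(G,\otimes)$ is a gyrogroup with gyrator $\mathrm{gyr}_G[a^{\epsilon},b^{\delta}](t^{+})=\mathrm{gyr}_{H^+}[a^+,b^+](t^+)$ and $\mathrm{gyr}_G[a^{\epsilon},b^{\delta}](t^{-})=(\mathrm{gyr}_{H^+}[a^+,b^+](t^+))^-$. *)

theory Defs
  imports Main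
begin

definition automorphism_on :: "'a set \<Rightarrow> ('a \<Rightarrow> 'a \<Rightarrow> 'a) \<Rightarrow> ('a \<Rightarrow> 'a) \<Rightarrow> bool" where
  "automorphism_on G op f \<longleftrightarrow>
     bij_betw f G G \<and> (\<forall>x\<in>G. \<forall>y\<in>G. f (op x y) = op (f x) (f y))"

text \<open>
  The gyrator is an explicit parameter. On the carrier it is determined by the operation
  (lemma \<open>gyrator_unique\<close> below); its values outside the carrier are irrelevant, which is why
  \<open>gyr a b = gyr (op a b) b\<close> is required pointwise on \<open>G\<close> only.
\<close>

definition gyrogroup :: "'a set \<Rightarrow> ('a \<Rightarrow> 'a \<Rightarrow> 'a) \<Rightarrow> ('a \<Rightarrow> 'a \<Rightarrow> 'a \<Rightarrow> 'a) \<Rightarrow> bool" where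
  "gyrogroup G op gyr \<longleftrightarrow>
     (\<forall>a\<in>G. \<forall>b\<in>G. op a b \<in> G) \<and>
     (\<exists>z\<in>G. (\<forall>x\<in>G. op z x = x) \<and> (\<forall>a\<in>G. \<exists>b\<in>G. op b a = z)) \<and>
     (\<forall>a\<in>G. \<forall>b\<in>G. automorphism_on G op (gyr a b)) \<and>
     (\<forall>a\<in>G. \<forall>b\<in>G. \<forall>c\<in>G. op a (op b c) = op (op a b) (gyr a b c)) \<and>
     (\<forall>a\<in>G. \<forall>b\<in>G. \<forall>c\<in>G. gyr a b c = gyr (op a b) b c)"

text \<open>
  \<open>H\<close> must be a gyrogroup for some gyrator of its own; separately, the gyrator of the ambient
  \<open>T\<close> must restrict to automorphisms of \<open>H\<close>.
\<close>

definition subgyrogroup ::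
    "'a set \<Rightarrow> 'a set \<Rightarrow> ('a \<Rightarrow> 'a \<Rightarrow> 'a) \<Rightarrow> ('a \<Rightarrow> 'a \<Rightarrow> 'a \<Rightarrow> 'a) \<Rightarrow> bool" where
  "subgyrogroup H T op gyr \<longleftrightarrow>
     gyrogroup T op gyr \<and> H \<noteq> {} \<and> H \<subseteq> T \<and>
     (\<exists>gyr'. gyrogroup H op gyr') \<and>
     (\<forall>a\<in>H. \<forall>b\<in>H. automorphism_on H op (gyr a b))"

text \<open>
  For the doubled gyrogroup on \<open>P \<union> \<phi> ` P\<close>, where \<open>P\<close> plays the role of \<open>H\<^sup>+\<close>:
  \<open>pos_part P \<phi>\<close> sends both \<open>x\<^sup>+\<close> and \<open>x\<^sup>- = \<phi> x\<^sup>+\<close> to \<open>x\<^sup>+\<close>, and membership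
  in \<open>P\<close> is the sign.
\<close>

definition pos_part :: "'a set \<Rightarrow> ('a \<Rightarrow> 'a) \<Rightarrow> 'a \<Rightarrow> 'a" where
  "pos_part P \<phi> x = (if x \<in> P then x else inv_into P \<phi> x)"

definition double_op ::
    "'a set \<Rightarrow> ('a \<Rightarrow> 'a) \<Rightarrow> ('a \<Rightarrow> 'a \<Rightarrow> 'a) \<Rightarrow> 'a \<Rightarrow> 'a \<Rightarrow> 'a" where
  "double_op P \<phi> op a b =
     (if (a \<in> P) = (b \<in> P) then op (pos_part P \<phi> a) (pos_part P \<phi> b)
      else \<phi> (op (pos_part P \<phi> a) (pos_part P \<phi> b)))"

definition double_gyr ::
    "'a set \<Rightarrow> ('a \<Rightarrow> 'a) \<Rightarrow> ('a \<Rightarrow> 'a \<Rightarrow> 'a \<Rightarrow> 'a) \<Rightarrow> 'a \<Rightarrow> 'a \<Rightarrow> 'a \<Rightarrow> 'a" where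
  "double_gyr P \<phi> gyr a b t =
     (if t \<in> P then gyr (pos_part P \<phi> a) (pos_part P \<phi> b) t
      else \<phi> (gyr (pos_part P \<phi> a) (pos_part P \<phi> b) (pos_part P \<phi> t)))"

lemma gyrogroup_left_cancel:
  assumes G: "gyrogroup G op gyr" and mem: "a \<in> G" "b \<in> G" "c \<in> G" and eq: "op a b = op a c"
  shows "b = c"
proof -
  from G obtain z where z: "z \<in> G" "\<forall>x\<in>G. op z x = x" "\<forall>a\<in>G. \<exists>b\<in>G. op b a = z"
    unfolding gyrogroup_def by blast
  then obtain a' where a': "a' \<in> G" "op a' a = z" using mem by blast
  have bij: "bij_betw (gyr a' a) G G"
    using G a' mem unfolding gyrogroup_def automorphism_on_def by blast
  have *: "op a' (op a x) = gyr a' a x" if "x \<in> G" for x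
  proof -
    have "op a' (op a x) = op (op a' a) (gyr a' a x)"
      using G a' mem that unfolding gyrogroup_def by blast
    then show ?thesis using a' z bij_betwE[OF bij] that by simp
  qed
  have "gyr a' a b = gyr a' a c" using * mem eq by metis
  then show ?thesis using bij mem unfolding bij_betw_def by (meson inj_onD)
qed

lemma gyrator_unique:
  assumes "gyrogroup G op gyr" "gyrogroup G op gyr'" "a \<in> G" "b \<in> G" "c \<in> G"
  shows "gyr a b c = gyr' a b c"
proof (rule gyrogroup_left_cancel[OF assms(1)])
  show "op a b \<in> G" using assms unfolding gyrogroup_def by blast
  show "gyr a b c \<in> G" "gyr' a b c \<in> G"
    using assms unfolding gyrogroup_def automorphism_on_def by (meson bij_betwE)+
  show "op (op a b) (gyr a b c) = op (op a b) (gyr' a b c)"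
    using assms unfolding gyrogroup_def by metis
qed

lemma gyrogroup_double:
  assumes P: "gyrogroup P op gyr" and disj: "P \<inter> M = {}" and \<phi>: "bij_betw \<phi> P M"
  shows "gyrogroup (P \<union> M) (double_op P \<phi> op) (double_gyr P \<phi> gyr)"
proof -
  let ?G = "P \<union> M" and ?p = "pos_part P \<phi>"
  let ?o = "double_op P \<phi> op" and ?g = "double_gyr P \<phi> gyr"
  have inj: "inj_on \<phi> P" and img: "\<phi> ` P = M" using \<phi> by (auto simp: bij_betw_def)
  have \<phi>P: "\<phi> x \<in> M" "\<phi> x \<notin> P" if "x \<in> P" for x using that img disj by auto
  have pP: "?p x \<in> P" if "x \<in> ?G" for x
    using that img by (auto simp: pos_part_def inv_into_into)
  have p\<phi>: "?p (\<phi> x) = x" if "x \<in> P" for x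
    using that \<phi>P inj by (simp add: pos_part_def)
  have pid: "?p x = x" if "x \<in> P" for x using that by (simp add: pos_part_def)
  have \<phi>p: "\<phi> (?p x) = x" if "x \<in> ?G" "x \<notin> P" for x
    using that img by (auto simp: pos_part_def f_inv_into_f)
  have ext: "x = y" if "x \<in> ?G" "y \<in> ?G" "?p x = ?p y" "(x \<in> P) = (y \<in> P)" for x y
    using that pid \<phi>p by metis
  have cl: "op a b \<in> P" if "a \<in> P" "b \<in> P" for a b
    using P that unfolding gyrogroup_def by blast
  have aut: "automorphism_on P op (gyr a b)" if "a \<in> P" "b \<in> P" for a b
    using P that unfolding gyrogroup_def by blast
  have gcl: "gyr a b c \<in> P" if "a \<in> P" "b \<in> P" "c \<in> P" for a b c
    using aut[OF that(1,2)] that(3) unfolding automorphism_on_def by (meson bij_betwE)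
  have ghom: "gyr a b (op x y) = op (gyr a b x) (gyr a b y)"
    if "a \<in> P" "b \<in> P" "x \<in> P" "y \<in> P" for a b x y
    using aut[OF that(1,2)] that(3,4) unfolding automorphism_on_def by blast
  have ass: "op a (op b c) = op (op a b) (gyr a b c)" if "a \<in> P" "b \<in> P" "c \<in> P" for a b c
    using P that unfolding gyrogroup_def by blast
  have loop: "gyr (op a b) b c = gyr a b c" if "a \<in> P" "b \<in> P" "c \<in> P" for a b c
    using P that unfolding gyrogroup_def by metis
  have oG: "?o a b \<in> ?G" and op_p: "?p (?o a b) = op (?p a) (?p b)"
    and os: "?o a b \<in> P \<longleftrightarrow> (a \<in> P) = (b \<in> P)" if "a \<in> ?G" "b \<in> ?G" for a b
    using cl[OF pP[OF that(1)] pP[OF that(2)]] \<phi>P p\<phi> pid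
    by (auto simp: double_op_def)
  have gG: "?g a b c \<in> ?G" and gp: "?p (?g a b c) = gyr (?p a) (?p b) (?p c)"
    and gs: "?g a b c \<in> P \<longleftrightarrow> c \<in> P" if "a \<in> ?G" "b \<in> ?G" "c \<in> ?G" for a b c
    using gcl[OF pP[OF that(1)] pP[OF that(2)] pP[OF that(3)]] \<phi>P p\<phi> pid
    by (auto simp: double_gyr_def)
  have unit: "\<exists>z\<in>?G. (\<forall>x\<in>?G. ?o z x = x) \<and> (\<forall>a\<in>?G. \<exists>b\<in>?G. ?o b a = z)"
  proof -
    from P obtain z where z: "z \<in> P" "\<forall>x\<in>P. op z x = x" "\<forall>a\<in>P. \<exists>b\<in>P. op b a = z"
      unfolding gyrogroup_def by blast
    have zG: "z \<in> ?G" using z by simp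
    have "?o z x = x" if "x \<in> ?G" for x
      by (rule ext) (use that z zG pP pid[OF z(1)] in \<open>simp_all only: oG op_p os simp_thms\<close>)
    moreover have "\<exists>b\<in>?G. ?o b a = z" if a: "a \<in> ?G" for a
    proof -
      obtain b where b: "b \<in> P" "op b (?p a) = z" using z pP[OF a] by blast
      define b' where "b' = (if a \<in> P then b else \<phi> b)"
      have b': "b' \<in> ?G" "?p b' = b" "b' \<in> P \<longleftrightarrow> a \<in> P"
        using b \<phi>P p\<phi> pid by (auto simp: b'_def)
      have "?o b' a = z"
        by (rule ext) (use a b b' z zG pid[OF z(1)] in \<open>simp_all only: oG op_p os simp_thms\<close>)
      then show ?thesis using b' by blast
    qed
    ultimately show ?thesis using zG by blast
  qed
  have autG: "automorphism_on ?G ?o (?g a b)" if ab: "a \<in> ?G" "b \<in> ?G" for a b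
  proof -
    have bij: "bij_betw (gyr (?p a) (?p b)) P P"
      using aut[OF pP[OF ab(1)] pP[OF ab(2)]] unfolding automorphism_on_def by blast
    have "inj_on (?g a b) ?G"
    proof (rule inj_onI)
      fix x y assume xy: "x \<in> ?G" "y \<in> ?G" "?g a b x = ?g a b y"
      have "?p x = ?p y"
        using bij xy pP gp[OF ab xy(1)] gp[OF ab xy(2)] unfolding bij_betw_def by (metis inj_onD)
      then show "x = y" using ext xy gs[OF ab xy(1)] gs[OF ab xy(2)] by metis
    qed
    moreover have "?G \<subseteq> ?g a b ` ?G"
    proof
      fix t assume t: "t \<in> ?G"
      obtain s where s: "s \<in> P" "gyr (?p a) (?p b) s = ?p t"
        using bij pP[OF t] unfolding bij_betw_def by (metis imageE)
      define s' where "s' = (if t \<in> P then s else \<phi> s)"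
      have s': "s' \<in> ?G" "?p s' = s" "s' \<in> P \<longleftrightarrow> t \<in> P"
        using s \<phi>P p\<phi> pid by (auto simp: s'_def)
      have "?g a b s' = t"
        by (rule ext) (use ab s s' t in \<open>simp_all only: gG gp gs simp_thms\<close>)
      then show "t \<in> ?g a b ` ?G" using s' by blast
    qed
    moreover have "?g a b ` ?G \<subseteq> ?G" using gG ab by blast
    moreover have "?g a b (?o x y) = ?o (?g a b x) (?g a b y)" if "x \<in> ?G" "y \<in> ?G" for x y
      by (rule ext) (use ab that in \<open>simp_all only: oG op_p os gG gp gs pP ghom\<close>)
    ultimately show ?thesis unfolding automorphism_on_def bij_betw_def by blast
  qed
  have assG: "?o a (?o b c) = ?o (?o a b) (?g a b c)" if "a \<in> ?G" "b \<in> ?G" "c \<in> ?G" for a b c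
  proof (rule ext)
    show "?p (?o a (?o b c)) = ?p (?o (?o a b) (?g a b c))"
      using that ass[OF pP[OF that(1)] pP[OF that(2)] pP[OF that(3)]]
      by (simp only: oG op_p gG gp)
    show "?o a (?o b c) \<in> P \<longleftrightarrow> ?o (?o a b) (?g a b c) \<in> P"
      using that by (simp only: oG os gG gs) blast
  qed (use that in \<open>simp_all only: oG gG\<close>)
  have loopG: "?g a b c = ?g (?o a b) b c" if "a \<in> ?G" "b \<in> ?G" "c \<in> ?G" for a b c
    by (rule ext) (use that in \<open>simp_all only: oG op_p gG gp gs pP loop\<close>)
  show ?thesis
    unfolding gyrogroup_def
    by (intro conjI ballI) (fact oG unit autG assG loopG)+
qed

end

(* The sign of an element makes G a Z/2-graded gyrogroup over H^+: writing B = A \<union> \<phi>(K) with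
   A, K \<subseteq> H^+, the set B is a subgyrogroup iff A and K contain inverses and the sums obey
   A+A, K+K \<subseteq> A and A+K, K+A \<subseteq> K. If A meets K, then \<phi>(0) lies in B and swaps A with K, giving
   case (3); otherwise case (2) holds. Conversely, in case (2) the only delicate inclusion is
   K+A \<subseteq> K: if y + a = b with a, b in A, then y = b + gyr[y,a](-a), and the loop property
   gyr[y,a] = gyr[b,a] shows that y lies in A. *)
theory Submission
  imports Defs
begin

text \<open>\<open>gyrogroup\<close> only asserts that an identity and left inverses exist. Naming
  them as \<open>z\<close> and \<open>i\<close> lets closure conditions mention them, and lets the
  doubled gyrogroup be interpreted with explicit choices of its own.\<close>

locale pointed_gyrogroup =
  fixes G :: "'a set" and op :: "'a \<Rightarrow> 'a \<Rightarrow> 'a" and gyr :: "'a \<Rightarrow> 'a \<Rightarrow> 'a \<Rightarrow> 'a"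
    and z :: 'a and i :: "'a \<Rightarrow> 'a"
  assumes gyrogroup: "gyrogroup G op gyr"
    and zero_closed: "z \<in> G"
    and zero_left: "x \<in> G \<Longrightarrow> op z x = x"
    and inv_closed: "x \<in> G \<Longrightarrow> i x \<in> G"
    and inv_left: "x \<in> G \<Longrightarrow> op (i x) x = z"
begin

section \<open>Cancellation laws and inverses\<close>

lemma closed: "a \<in> G \<Longrightarrow> b \<in> G \<Longrightarrow> op a b \<in> G"
  using gyrogroup unfolding gyrogroup_def by blast

lemma gyr_automorphism: "a \<in> G \<Longrightarrow> b \<in> G \<Longrightarrow> automorphism_on G op (gyr a b)"
  using gyrogroup unfolding gyrogroup_def by blast

lemma gyr_closed: "a \<in> G \<Longrightarrow> b \<in> G \<Longrightarrow> c \<in> G \<Longrightarrow> gyr a b c \<in> G"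
  using gyr_automorphism unfolding automorphism_on_def by (meson bij_betwE)

lemma gyr_assoc:
  "a \<in> G \<Longrightarrow> b \<in> G \<Longrightarrow> c \<in> G \<Longrightarrow> op a (op b c) = op (op a b) (gyr a b c)"
  using gyrogroup unfolding gyrogroup_def by blast

lemma gyr_loop: "a \<in> G \<Longrightarrow> b \<in> G \<Longrightarrow> c \<in> G \<Longrightarrow> gyr (op a b) b c = gyr a b c"
  using gyrogroup unfolding gyrogroup_def by metis

lemmas left_cancel = gyrogroup_left_cancel[OF gyrogroup]

lemma gyr_zero_left: "b \<in> G \<Longrightarrow> c \<in> G \<Longrightarrow> gyr z b c = c"
  by (rule left_cancel[of b])
    (use gyr_assoc[of z b c] in \<open>simp_all add: zero_closed zero_left closed gyr_closed\<close>)

text \<open>Since \<open>op b a = z\<close>, the loop property turns \<open>gyr b a\<close> into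
  \<open>gyr z a\<close>, which is the identity on \<open>G\<close>. Allowing any left inverse
  \<open>b\<close> instead of just \<open>i a\<close> lets the rule be reused for the pair
  \<open>a\<close>, \<open>i a\<close> in reverse order.\<close>

lemma left_inverse_cancel:
  assumes "a \<in> G" "b \<in> G" "x \<in> G" "op b a = z"
  shows "op b (op a x) = x"
  using assms gyr_assoc[of b a x] gyr_loop[of b a x] gyr_zero_left[of a x]
  by (simp add: zero_left)

text \<open>Cancel \<open>i a\<close> on the left: \<open>op (i a) (op a z)\<close> and
  \<open>op (i a) a\<close> both equal \<open>z\<close>.\<close>

lemma zero_right:
  assumes "a \<in> G" shows "op a z = a"
proof -
  have "op z z = z" by (simp add: zero_closed zero_left)
  have "op (i a) (op a z) = op (i a) a"
    using assms by (simp add: left_inverse_cancel zero_closed inv_closed inv_left)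
  then show ?thesis
    using assms left_cancel[of "i a"] closed zero_closed inv_closed by blast
qed

lemma left_inverse_imp_right:
  assumes "a \<in> G" "b \<in> G" "op b a = z"
  shows "op a b = z"
proof (rule left_cancel[of b])
  show "op b (op a b) = op b z"
    using assms by (simp add: left_inverse_cancel zero_right)
qed (use assms closed zero_closed in auto)

lemma inv_right: "a \<in> G \<Longrightarrow> op a (i a) = z"
  by (simp add: left_inverse_imp_right inv_closed inv_left)

text \<open>Only left cancellation is available, so both left inverses of \<open>a\<close> are first
  turned into right inverses.\<close>

lemma inv_unique:
  assumes "a \<in> G" "b \<in> G" "op b a = z"
  shows "b = i a"
  by (rule left_cancel[of a])
    (use assms in \<open>simp_all add: left_inverse_imp_right inv_closed inv_right\<close>)

lemma inv_inv: "a \<in> G \<Longrightarrow> i (i a) = a"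
  by (metis inv_unique inv_closed inv_right)

lemma inv_cancel_left: "a \<in> G \<Longrightarrow> x \<in> G \<Longrightarrow> op (i a) (op a x) = x"
  by (simp add: left_inverse_cancel inv_closed inv_left)

lemma cancel_inv_left: "a \<in> G \<Longrightarrow> x \<in> G \<Longrightarrow> op a (op (i a) x) = x"
  by (simp add: left_inverse_cancel inv_closed inv_right)

text \<open>Expressing the gyrator through the operation and inverses shows that a subset closed
  under these is closed under gyrations as well.\<close>

lemma gyr_eq:
  assumes "a \<in> G" "b \<in> G" "c \<in> G"
  shows "gyr a b c = op (i (op a b)) (op a (op b c))"
  using assms by (simp add: gyr_assoc inv_cancel_left closed gyr_closed)

section \<open>Subgyrogroups as subsets closed under the operation and inverses\<close>

lemma subgyrogroupI:
  assumes H: "H \<noteq> {}" "H \<subseteq> G"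
    and cl: "\<And>a b. a \<in> H \<Longrightarrow> b \<in> H \<Longrightarrow> op a b \<in> H"
    and inv: "\<And>a. a \<in> H \<Longrightarrow> i a \<in> H"
  shows "subgyrogroup H G op gyr"
proof -
  have G: "a \<in> G" if "a \<in> H" for a using that H by blast
  have zH: "z \<in> H" using H inv_left inv cl by (metis ex_in_conv subsetD)
  have gyrH: "gyr a b c \<in> H" if "a \<in> H" "b \<in> H" "c \<in> H" for a b c
    using that by (simp add: gyr_eq G cl inv)
  have aut: "automorphism_on H op (gyr a b)" if ab: "a \<in> H" "b \<in> H" for a b
  proof -
    have autG: "automorphism_on G op (gyr a b)" using gyr_automorphism G ab by blast
    have "inj_on (gyr a b) H"
      using autG H unfolding automorphism_on_def bij_betw_def by (meson inj_on_subset)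
    moreover have "gyr a b ` H = H"
    proof
      show "gyr a b ` H \<subseteq> H" using gyrH ab by blast
      show "H \<subseteq> gyr a b ` H"
      proof
        fix d assume d: "d \<in> H"
        \<comment> \<open>By \<open>gyr_eq\<close>, a preimage of \<open>d\<close> must solve
          \<open>op a (op b c) = op (op a b) d\<close>; peeling off \<open>a\<close> and then
          \<open>b\<close> from the left gives this \<open>c\<close>.\<close>
        define c where "c = op (i b) (op (i a) (op (op a b) d))"
        have c: "c \<in> H" unfolding c_def using ab d cl inv by simp
        have "op a (op b c) = op (op a b) d"
          unfolding c_def using ab d by (simp add: cancel_inv_left G cl inv)
        then have "gyr a b c = d"
          using ab c d by (simp add: gyr_eq inv_cancel_left G cl)
        then show "d \<in> gyr a b ` H" using c by blast
      qed
    qed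
    ultimately show ?thesis
      using autG H unfolding automorphism_on_def bij_betw_def by blast
  qed
  have "gyrogroup H op gyr"
    unfolding gyrogroup_def
  proof (intro conjI ballI)
    show "\<exists>z\<in>H. (\<forall>x\<in>H. op z x = x) \<and> (\<forall>a\<in>H. \<exists>b\<in>H. op b a = z)"
      using zH zero_left inv_left inv G by metis
  qed (use cl aut gyr_assoc gyr_loop G in auto)
  then show ?thesis
    unfolding subgyrogroup_def using gyrogroup H aut by blast
qed

lemma subgyrogroup_iff:
  "subgyrogroup H G op gyr \<longleftrightarrow>
     H \<noteq> {} \<and> H \<subseteq> G \<and> (\<forall>a\<in>H. \<forall>b\<in>H. op a b \<in> H) \<and> (\<forall>a\<in>H. i a \<in> H)"
proof
  assume sub: "subgyrogroup H G op gyr"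
  then have H: "H \<noteq> {}" "H \<subseteq> G" unfolding subgyrogroup_def by auto
  from sub obtain gyr' where gH: "gyrogroup H op gyr'" unfolding subgyrogroup_def by blast
  then obtain e where e: "e \<in> H" "\<forall>x\<in>H. op e x = x" "\<forall>a\<in>H. \<exists>b\<in>H. op b a = e"
    unfolding gyrogroup_def by blast
  \<comment> \<open>The identity \<open>e\<close> of \<open>H\<close> satisfies
    \<open>op e e = e = op e z\<close>, so \<open>e\<close> cancels. The left inverses found in
    \<open>H\<close> are then those given by \<open>i\<close>.\<close>
  have "e = z"
    using left_cancel[of e e z] e H zero_right zero_closed by auto
  then have "i a \<in> H" if "a \<in> H" for a
    using e(3) that inv_unique H by (metis subsetD)
  moreover have "\<forall>a\<in>H. \<forall>b\<in>H. op a b \<in> H" using gH unfolding gyrogroup_def by blast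
  ultimately show "H \<noteq> {} \<and> H \<subseteq> G \<and> (\<forall>a\<in>H. \<forall>b\<in>H. op a b \<in> H) \<and> (\<forall>a\<in>H. i a \<in> H)"
    using H by blast
qed (blast intro: subgyrogroupI)

lemma subgyrogroup_gyr_closed:
  "subgyrogroup H G op gyr \<Longrightarrow> a \<in> H \<Longrightarrow> b \<in> H \<Longrightarrow> c \<in> H \<Longrightarrow> gyr a b c \<in> H"
  unfolding subgyrogroup_def automorphism_on_def by (meson bij_betwE)

lemma subgyrogroup_left_quotient:
  assumes "subgyrogroup H G op gyr" "a \<in> H" "x \<in> G" "op a x \<in> H"
  shows "x \<in> H"
  using assms inv_cancel_left[of a x] unfolding subgyrogroup_iff by (metis subsetD)

lemma subgyrogroup_right_quotient:
  assumes H: "subgyrogroup H G op gyr" and "a \<in> H" "x \<in> G" "op x a \<in> H"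
  shows "x \<in> H"
proof -
  have aG: "a \<in> G" "i a \<in> H" using assms unfolding subgyrogroup_iff by auto
  have "x = op x (op a (i a))" using aG assms by (simp add: inv_right zero_right)
  also have "\<dots> = op (op x a) (gyr x a (i a))" using aG assms by (simp add: gyr_assoc inv_closed)
  \<comment> \<open>The element \<open>x\<close> is not yet known to lie in \<open>H\<close>. The
    loop property replaces it by \<open>op x a\<close>, which does, so the gyration preserves
    \<open>H\<close>.\<close>
  also have "\<dots> = op (op x a) (gyr (op x a) a (i a))"
    using aG assms by (simp add: gyr_loop inv_closed)
  also have "\<dots> \<in> H"
    using subgyrogroup_gyr_closed[OF H assms(4) assms(2) aG(2)] assms unfolding subgyrogroup_iff by blast
  finally show ?thesis .
qed

section \<open>Subgyrogroups of the doubled gyrogroup\<close>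

text \<open>The closure criterion, applied in the doubled gyrogroup, splits by signs: two conditions
  for inverses and four for sums, all phrased in \<open>G\<close>.\<close>

lemma double_subgyrogroup_iff:
  assumes disj: "G \<inter> M = {}" and \<phi>: "bij_betw \<phi> G M" and AK: "A \<subseteq> G" "K \<subseteq> G"
  shows "subgyrogroup (A \<union> \<phi> ` K) (G \<union> M) (double_op G \<phi> op) (double_gyr G \<phi> gyr) \<longleftrightarrow>
    A \<union> K \<noteq> {} \<and> (\<forall>a\<in>A. i a \<in> A) \<and> (\<forall>a\<in>K. i a \<in> K) \<and>
    (\<forall>a\<in>A. \<forall>b\<in>A. op a b \<in> A) \<and> (\<forall>a\<in>A. \<forall>b\<in>K. op a b \<in> K) \<and>
    (\<forall>a\<in>K. \<forall>b\<in>A. op a b \<in> K) \<and> (\<forall>a\<in>K. \<forall>b\<in>K. op a b \<in> A)"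
proof -
  let ?p = "pos_part G \<phi>" and ?o = "double_op G \<phi> op"
  \<comment> \<open>The inverse in the doubled gyrogroup preserves the sign, because the identity is
    the positive element \<open>z\<close> and opposite signs give a negative result.\<close>
  define j where "j x = (if x \<in> G then i x else \<phi> (i (?p x)))" for x
  have inj: "inj_on \<phi> G" and img: "\<phi> ` G = M" using \<phi> by (auto simp: bij_betw_def)
  have neg: "\<phi> x \<in> M" "\<phi> x \<notin> G" if "x \<in> G" for x using that img disj by auto
  have p_pos: "?p x = x" if "x \<in> G" for x using that by (simp add: pos_part_def)
  have p_neg: "?p (\<phi> x) = x" if "x \<in> G" for x
    using that neg inj by (simp add: pos_part_def)
  have op_simps: "?o a b = op a b" "?o a (\<phi> b) = \<phi> (op a b)"
    "?o (\<phi> a) b = \<phi> (op a b)" "?o (\<phi> a) (\<phi> b) = op a b" if "a \<in> G" "b \<in> G" for a b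
    using that neg p_pos p_neg by (auto simp: double_op_def)
  have j_simps: "j a = i a" "j (\<phi> a) = \<phi> (i a)" if "a \<in> G" for a
    using that neg p_neg by (auto simp: j_def)
  interpret D: pointed_gyrogroup "G \<union> M" ?o "double_gyr G \<phi> gyr" z j
  proof
    show "gyrogroup (G \<union> M) ?o (double_gyr G \<phi> gyr)"
      by (rule gyrogroup_double[OF gyrogroup disj \<phi>])
    show "z \<in> G \<union> M" by (simp add: zero_closed)
    fix x assume "x \<in> G \<union> M"
    then consider "x \<in> G" | y where "y \<in> G" "x = \<phi> y" using img by blast
    then show "?o z x = x" "j x \<in> G \<union> M" "?o (j x) x = z"
      by (cases; simp add: op_simps j_simps zero_closed zero_left inv_closed inv_left neg)+
  qed
  have mem: "x \<in> A \<union> \<phi> ` K \<longleftrightarrow> x \<in> A" "\<phi> x \<in> A \<union> \<phi> ` K \<longleftrightarrow> x \<in> K" if "x \<in> G" for x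
    using that AK neg inj by (auto dest: inj_onD)
  have G: "x \<in> A \<Longrightarrow> x \<in> G" "x \<in> K \<Longrightarrow> x \<in> G" for x using AK by auto
  have "(\<forall>a\<in>A \<union> \<phi> ` K. j a \<in> A \<union> \<phi> ` K) \<longleftrightarrow> (\<forall>a\<in>A. i a \<in> A) \<and> (\<forall>a\<in>K. i a \<in> K)"
    unfolding ball_Un ball_simps
    by (simp add: j_simps mem G inv_closed del: Un_iff)
  moreover have "(\<forall>a\<in>A \<union> \<phi> ` K. \<forall>b\<in>A \<union> \<phi> ` K. ?o a b \<in> A \<union> \<phi> ` K) \<longleftrightarrow>
    (\<forall>a\<in>A. \<forall>b\<in>A. op a b \<in> A) \<and> (\<forall>a\<in>A. \<forall>b\<in>K. op a b \<in> K) \<and>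
    (\<forall>a\<in>K. \<forall>b\<in>A. op a b \<in> K) \<and> (\<forall>a\<in>K. \<forall>b\<in>K. op a b \<in> A)"
    unfolding ball_Un ball_simps
    by (auto simp add: op_simps mem G closed simp del: Un_iff)
  moreover have "A \<union> \<phi> ` K \<subseteq> G \<union> M" using AK img by blast
  ultimately show ?thesis unfolding D.subgyrogroup_iff by auto
qed

end

lemma gyrogroup_pointed:
  assumes "gyrogroup G op gyr"
  obtains z i where "pointed_gyrogroup G op gyr z i"
proof -
  from assms obtain z where z: "z \<in> G" "\<forall>x\<in>G. op z x = x" "\<forall>a\<in>G. \<exists>b\<in>G. op b a = z"
    unfolding gyrogroup_def by blast
  from z(3) obtain i where "\<forall>a\<in>G. i a \<in> G \<and> op (i a) a = z" by metis
  then have "pointed_gyrogroup G op gyr z i"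
    using assms z by unfold_locales auto
  then show ?thesis by (rule that)
qed

theorem theorem2p12:
  fixes Hp Hm B :: "'a set"
    and op :: "'a \<Rightarrow> 'a \<Rightarrow> 'a"
    and gyr :: "'a \<Rightarrow> 'a \<Rightarrow> 'a \<Rightarrow> 'a"
    and \<phi> :: "'a \<Rightarrow> 'a"
  assumes "gyrogroup Hp op gyr"
    and "Hp \<inter> Hm = {}"
    and "bij_betw \<phi> Hp Hm"
    and "B \<noteq> {}" and "B \<subseteq> Hp \<union> Hm"
  shows "subgyrogroup B (Hp \<union> Hm) (double_op Hp \<phi> op) (double_gyr Hp \<phi> gyr) \<longleftrightarrow>
      subgyrogroup B Hp op gyr \<or>
      (\<exists>A L. subgyrogroup A Hp op gyr \<and> L \<subseteq> Hm \<and> B = A \<union> L \<and>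
         (\<forall>x\<in>L. \<forall>y\<in>L. double_op Hp \<phi> op x y \<in> A) \<and>
         A \<inter> {h \<in> Hp. \<phi> h \<in> L} = {} \<and>
         subgyrogroup (A \<union> {h \<in> Hp. \<phi> h \<in> L}) Hp op gyr) \<or>
      (\<exists>A. subgyrogroup A Hp op gyr \<and> B = A \<union> \<phi> ` A)"
proof -
  obtain z i where "pointed_gyrogroup Hp op gyr z i"
    using gyrogroup_pointed[OF assms(1)] .
  then interpret pointed_gyrogroup Hp op gyr z i .
  have inj: "inj_on \<phi> Hp" and img: "\<phi> ` Hp = Hm" using assms(3) by (auto simp: bij_betw_def)
  note double_iff = double_subgyrogroup_iff[OF assms(2,3)]
  let ?o = "double_op Hp \<phi> op"
  have op_neg: "?o (\<phi> x) (\<phi> y) = op x y" if "x \<in> Hp" "y \<in> Hp" for x y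
    using that img assms(2) inj by (auto simp: double_op_def pos_part_def)
  let ?S = "subgyrogroup B (Hp \<union> Hm) ?o (double_gyr Hp \<phi> gyr)"
  let ?sub = "\<lambda>A. subgyrogroup A Hp op gyr"
  let ?K = "\<lambda>L. {h \<in> Hp. \<phi> h \<in> L}"
  let ?two = "\<lambda>A L. ?sub A \<and> L \<subseteq> Hm \<and> B = A \<union> L \<and> (\<forall>x\<in>L. \<forall>y\<in>L. ?o x y \<in> A) \<and>
    A \<inter> ?K L = {} \<and> ?sub (A \<union> ?K L)"
  have K_img: "\<phi> ` ?K L = L" if "L \<subseteq> Hm" for L using that img by auto
  show ?thesis
  proof (intro iffI; (elim disjE exE)?)
    assume S: ?S
    define A L K where "A = B \<inter> Hp" and "L = B \<inter> Hm" and "K = ?K L"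
    have AK: "A \<subseteq> Hp" "K \<subseteq> Hp" and L: "L \<subseteq> Hm" "\<phi> ` K = L" and B: "B = A \<union> L"
      using assms(5) K_img[of L] by (auto simp: A_def L_def K_def)
    from S have *: "A \<union> K \<noteq> {}" "\<forall>a\<in>A. i a \<in> A" "\<forall>a\<in>K. i a \<in> K"
      "\<forall>a\<in>A. \<forall>b\<in>A. op a b \<in> A" "\<forall>a\<in>A. \<forall>b\<in>K. op a b \<in> K"
      "\<forall>a\<in>K. \<forall>b\<in>A. op a b \<in> K" "\<forall>a\<in>K. \<forall>b\<in>K. op a b \<in> A"
      using double_iff[OF AK] unfolding B L(2) by auto
    \<comment> \<open>If \<open>K\<close> has an element, its sum with itself lies in
      \<open>A\<close>.\<close>
    have "A \<noteq> {}" using *(1,7) by blast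
    then have subA: "?sub A" using * AK by (intro subgyrogroupI) auto
    have subAK: "?sub (A \<union> K)" using * AK by (intro subgyrogroupI) auto
    show "?sub B \<or> (\<exists>A L. ?two A L) \<or> (\<exists>A. ?sub A \<and> B = A \<union> \<phi> ` A)"
    proof (cases "A \<inter> K = {}")
      case True
      have "\<forall>x\<in>L. \<forall>y\<in>L. ?o x y \<in> A"
        using *(7) unfolding L(2)[symmetric] by (simp add: op_neg subsetD[OF AK(2)])
      then have "?two A L"
        using True subA subAK L(1) B unfolding K_def by (intro conjI)
      then show ?thesis by (intro disjI2 disjI1 exI)
    next
      case False
      then obtain a where "a \<in> A" "a \<in> K" by blast
      \<comment> \<open>Here \<open>z = op (i a) a\<close> with \<open>i a\<close> in
        \<open>A\<close> and \<open>a\<close> in \<open>K\<close>. Adding \<open>z\<close> on the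
        left then sends \<open>A\<close> into \<open>K\<close> and \<open>K\<close> into
        \<open>A\<close>, without changing any element.\<close>
      then have zK: "z \<in> K" using *(2,5) AK inv_left by (metis subsetD)
      have "A \<subseteq> K" using zK *(6) AK(1) zero_left by (metis subsetD subsetI)
      moreover have "K \<subseteq> A" using zK *(7) AK(2) zero_left by (metis subsetD subsetI)
      ultimately have "B = A \<union> \<phi> ` A" using B L(2) by simp
      then show ?thesis using subA by (intro disjI2 exI conjI)
    qed
  next
    assume "?sub B"
    \<comment> \<open>Case (1) is the instance with no negative elements.\<close>
    then show ?S using double_iff[of B "{}"] unfolding subgyrogroup_iff by simp
  next
    fix A L assume two: "?two A L"
    define K where "K = ?K L"
    have sub: "?sub A" "?sub (A \<union> K)" and disj: "A \<inter> K = {}" and L: "L = \<phi> ` K"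
      and LL: "\<forall>x\<in>L. \<forall>y\<in>L. ?o x y \<in> A" and B: "B = A \<union> L"
      using two K_img[of L] by (auto simp: K_def)
    have AK: "A \<subseteq> Hp" "K \<subseteq> Hp" using sub by (auto simp: subgyrogroup_iff)
    have KK: "\<forall>a\<in>K. \<forall>b\<in>K. op a b \<in> A" using LL unfolding L by (simp add: op_neg subsetD[OF AK(2)])
    have inv: "\<forall>a\<in>A. i a \<in> A" and AA: "\<forall>a\<in>A. \<forall>b\<in>A. op a b \<in> A" and ne: "A \<union> K \<noteq> {}"
      using sub unfolding subgyrogroup_iff by auto
    have sum: "op a b \<in> A \<union> K" if "a \<in> A \<union> K" "b \<in> A \<union> K" for a b
      using sub(2) that unfolding subgyrogroup_iff by blast
    have "op a b \<in> K" if "a \<in> A" "b \<in> K" for a b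
    proof -
      \<comment> \<open>Otherwise the quotient \<open>b\<close> would lie in \<open>A\<close>,
        contradicting disjointness from \<open>K\<close>; so the sum, being in
        \<open>A \<union> K\<close>, falls in \<open>K\<close>.\<close>
      have "op a b \<notin> A"
        using subgyrogroup_left_quotient[OF sub(1) that(1) subsetD[OF AK(2) that(2)]] that(2) disj
        by blast
      then show ?thesis using sum that by blast
    qed
    moreover have "op b a \<in> K" if "a \<in> A" "b \<in> K" for a b
    proof -
      have "op b a \<notin> A"
        using subgyrogroup_right_quotient[OF sub(1) that(1) subsetD[OF AK(2) that(2)]] that(2) disj
        by blast
      then show ?thesis using sum that by blast
    qed
    moreover have "i b \<in> K" if b: "b \<in> K" for b
    proof -
      \<comment> \<open>If \<open>i b\<close> were in \<open>A\<close>, then so would be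
        \<open>i (i b) = b\<close>.\<close>
      have "i b \<notin> A"
        using b inv disj inv_inv[of b] AK(2) by (metis disjoint_iff subsetD)
      then show ?thesis using b sub(2) unfolding subgyrogroup_iff by blast
    qed
    ultimately show ?S
      unfolding B L double_iff[OF AK] using inv AA ne KK by (intro conjI) auto
  next
    fix A assume "?sub A \<and> B = A \<union> \<phi> ` A"
    \<comment> \<open>With \<open>K = A\<close> the sign conditions all collapse to closure of
      \<open>A\<close>.\<close>
    then show ?S using double_iff[of A A] unfolding subgyrogroup_iff by simp
  qed
qed

end
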